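(* Let $E$ be a finite orthoalgebra with (distinct) blocks $B_1,\dots,B_m$, and let $n\ge 0$. Then the sequence $$0\to C_\lambda^n(E)\xrightarrow{\ r\ }\bigoplus_i C_\lambda^n(B_i)\xrightarrow{\ \delta_1\ }\bigoplus_{i_1<i_2}C_\lambda^n(B_{i_1}\cap B_{i_2})\xrightarrow{\ \delta_2\ }\bigoplus_{i_1<i_2<i_3}C_\lambda^n(B_{i_1}\cap B_{i_2}\cap B_{i_3})\xrightarrow{\ \delta_3\ }\cdots$$ is exact, where $r(\alpha)=(\alpha|_{T_n(B_i)})_i$ and, for $k\ge1$ and $\overline{\alpha}=(\alpha_{i_1\ldots i_k})_{i_1<\cdots<i_k}$, the component of $\delta_k(\overline{\alpha})$ with index $i_1<\cdots<i_{k+1}$ is $$\sum_{j=1}^{k+1}(-1)^{j+1}\,\alpha_{i_1\ldots\widehat{i_j}\ldots i_{k+1}}\big|_{T_n(B_{i_1}\cap\cdots\cap B_{i_{k+1}})},$$ the hat denoting omission of an index.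
   Context: An effect algebra is a set $A$ with a partial binary operation $\boxplus$, a unary operation $(-)^\bot$ and elements $0,1\in A$ such that: if $a\boxplus b$ is defined then so is $b\boxplus a$ and they are equal; if $a\boxplus b$ and $(a\boxplus b)\boxplus c$ are defined then so are $b\boxplus c$ and $a\boxplus(b\boxplus c)$, and $(a\boxplus b)\boxplus c=a\boxplus(b\boxplus c)$; $0\boxplus a$ is always defined and equals $a$; for each $a$, $a^\bot$ is the unique element with $a\boxplus a^\bot=1$; if $a\boxplus 1$ is defined then $a=0$. An orthoalgebra is an effect algebra in which $a\boxplus a$ is never defined unless $a=0$. A subalgebra of an effect algebra $E$ is a subset containing $0,1$, closed under $(-)^\bot$ and under all sums that are defined in $E$, with $\boxplus$ restricted from $E$. A Boolean algebra is regarded as an effect algebra in which $a\boxplus b$ is defined iff $a\wedge b=0$, and then $a\boxplus b=a\vee b$. A block of $E$ is a maximal Boolean subalgebra of $E$; a finite orthoalgebra is the union of its blocks. All indices $i,i_1,i_2,\ldots$ range over $\{1,\dots,m\}$. For an effect algebra $A$ and $n\ge 0$ let $T_n(A)=\{(a_0,\dots,a_n)\in A^{n+1}\mid a_0\boxplus\cdots\boxplus a_n\text{ is defined and equals }1\}$, and let $C_\lambda^n(A)$ be the real vector space of functions $\alpha:T_n(A)\to\mathbb{R}$ with $\alpha(a_0,\dots,a_n)=(-1)^n\alpha(a_n,a_0,\dots,a_{n-1})$ for all $(a_0,\dots,a_n)\in T_n(A)$. *)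

theory Defs
  imports
    "HOL-Analysis.Analysis"
    "HOL-Library.Function_Algebras"
    "HOL-Algebra.Congruence"
begin

section \<open>Effect algebras\<close>

text \<open>\<open>osum E a b = None\<close> means that the sum of \<open>a\<close> and \<open>b\<close> is undefined.
  Only the values of \<open>osum\<close> and \<open>orth\<close> on the carrier are relevant.\<close>

record 'a effect_alg = "'a partial_object" +
  osum :: "'a \<Rightarrow> 'a \<Rightarrow> 'a option"
  orth :: "'a \<Rightarrow> 'a"
  ezero :: 'a
  eone :: 'a

locale effect_algebra =
  fixes E :: "'a effect_alg"
  assumes zero_closed: "ezero E \<in> carrier E"
    and one_closed: "eone E \<in> carrier E"
    and orth_closed: "a \<in> carrier E \<Longrightarrow> orth E a \<in> carrier E"
    and osum_closed:
      "\<lbrakk>a \<in> carrier E; b \<in> carrier E; osum E a b = Some c\<rbrakk> \<Longrightarrow> c \<in> carrier E"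
    and osum_comm:
      "\<lbrakk>a \<in> carrier E; b \<in> carrier E; osum E a b = Some c\<rbrakk> \<Longrightarrow> osum E b a = Some c"
    and osum_assoc:
      "\<lbrakk>a \<in> carrier E; b \<in> carrier E; c \<in> carrier E; osum E a b = Some d; osum E d c = Some e\<rbrakk>
        \<Longrightarrow> \<exists>f. osum E b c = Some f \<and> osum E a f = Some e"
    and osum_zero: "a \<in> carrier E \<Longrightarrow> osum E (ezero E) a = Some a"
    and osum_orth: "a \<in> carrier E \<Longrightarrow> osum E a (orth E a) = Some (eone E)"
    and orth_unique:
      "\<lbrakk>a \<in> carrier E; b \<in> carrier E; osum E a b = Some (eone E)\<rbrakk> \<Longrightarrow> b = orth E a"
    and osum_one: "\<lbrakk>a \<in> carrier E; osum E a (eone E) \<noteq> None\<rbrakk> \<Longrightarrow> a = ezero E"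

locale orthoalgebra = effect_algebra +
  assumes osum_self: "\<lbrakk>a \<in> carrier E; osum E a a \<noteq> None\<rbrakk> \<Longrightarrow> a = ezero E"

definition subalgebra :: "'a set \<Rightarrow> 'a effect_alg \<Rightarrow> bool" where
  "subalgebra S E \<longleftrightarrow> S \<subseteq> carrier E \<and> ezero E \<in> S \<and> eone E \<in> S \<and>
    (\<forall>a\<in>S. orth E a \<in> S) \<and>
    (\<forall>a\<in>S. \<forall>b\<in>S. \<forall>c. osum E a b = Some c \<longrightarrow> c \<in> S)"

definition subalg :: "'a effect_alg \<Rightarrow> 'a set \<Rightarrow> 'a effect_alg" where
  "subalg E S = E\<lparr>carrier := S\<rparr>"


section \<open>Boolean algebras and blocks\<close>

text \<open>The axioms of \<^locale>\<open>abstract_boolean_algebra\<close>, relativised to a set.\<close>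

locale boolean_algebra_on =
  fixes S :: "'a set" and meet join :: "'a \<Rightarrow> 'a \<Rightarrow> 'a" and compl :: "'a \<Rightarrow> 'a"
    and bottom top :: 'a
  assumes bottom_in: "bottom \<in> S" and top_in: "top \<in> S"
    and compl_in: "x \<in> S \<Longrightarrow> compl x \<in> S"
    and meet_in: "\<lbrakk>x \<in> S; y \<in> S\<rbrakk> \<Longrightarrow> meet x y \<in> S"
    and join_in: "\<lbrakk>x \<in> S; y \<in> S\<rbrakk> \<Longrightarrow> join x y \<in> S"
    and meet_assoc:
      "\<lbrakk>x \<in> S; y \<in> S; z \<in> S\<rbrakk> \<Longrightarrow> meet (meet x y) z = meet x (meet y z)"
    and join_assoc:
      "\<lbrakk>x \<in> S; y \<in> S; z \<in> S\<rbrakk> \<Longrightarrow> join (join x y) z = join x (join y z)"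
    and meet_comm: "\<lbrakk>x \<in> S; y \<in> S\<rbrakk> \<Longrightarrow> meet x y = meet y x"
    and join_comm: "\<lbrakk>x \<in> S; y \<in> S\<rbrakk> \<Longrightarrow> join x y = join y x"
    and meet_join_distrib:
      "\<lbrakk>x \<in> S; y \<in> S; z \<in> S\<rbrakk> \<Longrightarrow> meet x (join y z) = join (meet x y) (meet x z)"
    and join_meet_distrib:
      "\<lbrakk>x \<in> S; y \<in> S; z \<in> S\<rbrakk> \<Longrightarrow> join x (meet y z) = meet (join x y) (join x z)"
    and meet_top: "x \<in> S \<Longrightarrow> meet x top = x"
    and join_bottom: "x \<in> S \<Longrightarrow> join x bottom = x"
    and meet_compl: "x \<in> S \<Longrightarrow> meet x (compl x) = bottom"
    and join_compl: "x \<in> S \<Longrightarrow> join x (compl x) = top"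

definition boolean_effect_algebra :: "'a effect_alg \<Rightarrow> bool" where
  "boolean_effect_algebra A \<longleftrightarrow> (\<exists>meet join.
    boolean_algebra_on (carrier A) meet join (orth A) (ezero A) (eone A) \<and>
    (\<forall>a\<in>carrier A. \<forall>b\<in>carrier A.
      osum A a b = (if meet a b = ezero A then Some (join a b) else None)))"

definition boolean_subalgebra :: "'a set \<Rightarrow> 'a effect_alg \<Rightarrow> bool" where
  "boolean_subalgebra S E \<longleftrightarrow> subalgebra S E \<and> boolean_effect_algebra (subalg E S)"

definition block :: "'a effect_alg \<Rightarrow> 'a set \<Rightarrow> bool" where
  "block E S \<longleftrightarrow> boolean_subalgebra S E \<and>
    (\<forall>T. boolean_subalgebra T E \<and> S \<subseteq> T \<longrightarrow> T = S)"


section \<open>Cyclic cochains\<close>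

text \<open>Iterated sums are bracketed to the left; the value on the empty list is not used below.\<close>

fun osum_list :: "'a effect_alg \<Rightarrow> 'a list \<Rightarrow> 'a option" where
  "osum_list A [] = Some (ezero A)"
| "osum_list A [a] = Some a"
| "osum_list A (a # b # as) =
    (case osum A a b of None \<Rightarrow> None | Some c \<Rightarrow> osum_list A (c # as))"

text \<open>The tuple \<open>(a\<^sub>0, \<dots>, a\<^sub>n)\<close> is represented by a list of length \<open>n + 1\<close>.\<close>

definition tests :: "nat \<Rightarrow> 'a effect_alg \<Rightarrow> 'a list set" where
  "tests n A = {as. length as = n + 1 \<and> set as \<subseteq> carrier A \<and> osum_list A as = Some (eone A)}"

instantiation "fun" :: (type, real_vector) real_vector
begin

definition scaleR_fun :: "real \<Rightarrow> ('a \<Rightarrow> 'b) \<Rightarrow> 'a \<Rightarrow> 'b" where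
  "scaleR_fun c f = (\<lambda>x. c *\<^sub>R f x)"

instance
  by standard (simp_all add: scaleR_fun_def fun_eq_iff scaleR_add_right scaleR_add_left)

end

text \<open>A function on \<open>T\<close> is represented by its extension by zero to the whole type.\<close>

definition restrict_zero :: "('b \<Rightarrow> real) \<Rightarrow> 'b set \<Rightarrow> 'b \<Rightarrow> real" where
  "restrict_zero \<alpha> T = (\<lambda>t. if t \<in> T then \<alpha> t else 0)"

definition cyclic_cochains :: "nat \<Rightarrow> 'a effect_alg \<Rightarrow> ('a list \<Rightarrow> real) set" where
  "cyclic_cochains n A = {\<alpha>.
    (\<forall>as\<in>tests n A. \<alpha> as = (-1) ^ n * \<alpha> (last as # butlast as)) \<and>
    (\<forall>as. as \<notin> tests n A \<longrightarrow> \<alpha> as = 0)}"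


section \<open>The sequence associated with a family of subalgebras\<close>

text \<open>The index \<open>i\<^sub>1 < \<dots> < i\<^sub>k\<close> is represented by the list \<open>[i\<^sub>1, \<dots>, i\<^sub>k]\<close>.\<close>

definition indices :: "nat \<Rightarrow> nat \<Rightarrow> nat list set" where
  "indices m k = {is. length is = k \<and> set is \<subseteq> {1..m} \<and> sorted_wrt (<) is}"

text \<open>Omission of the \<open>j\<close>-th entry, counted from 1.\<close>

definition omit :: "nat \<Rightarrow> 'b list \<Rightarrow> 'b list" where
  "omit j xs = take (j - 1) xs @ drop j xs"

definition intersection :: "'a effect_alg \<Rightarrow> (nat \<Rightarrow> 'a set) \<Rightarrow> nat list \<Rightarrow> 'a effect_alg" where
  "intersection E B is = subalg E (\<Inter>i\<in>set is. B i)"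

text \<open>The direct sum indexed by \<open>i\<^sub>1 < \<dots> < i\<^sub>k\<close>; since the index set is finite,
  its elements are all families, again extended by zero outside the index set.\<close>

definition cochain_sum ::
    "'a effect_alg \<Rightarrow> nat \<Rightarrow> (nat \<Rightarrow> 'a set) \<Rightarrow> nat \<Rightarrow> nat \<Rightarrow> (nat list \<Rightarrow> 'a list \<Rightarrow> real) set" where
  "cochain_sum E m B n k = {\<alpha>.
    (\<forall>is\<in>indices m k. \<alpha> is \<in> cyclic_cochains n (intersection E B is)) \<and>
    (\<forall>is. is \<notin> indices m k \<longrightarrow> \<alpha> is = 0)}"

definition restriction_map ::
    "'a effect_alg \<Rightarrow> nat \<Rightarrow> (nat \<Rightarrow> 'a set) \<Rightarrow> nat \<Rightarrow>
      ('a list \<Rightarrow> real) \<Rightarrow> nat list \<Rightarrow> 'a list \<Rightarrow> real" where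
  "restriction_map E m B n \<alpha> = (\<lambda>is.
    if is \<in> indices m 1 then restrict_zero \<alpha> (tests n (intersection E B is)) else 0)"

definition coboundary ::
    "'a effect_alg \<Rightarrow> nat \<Rightarrow> (nat \<Rightarrow> 'a set) \<Rightarrow> nat \<Rightarrow> nat \<Rightarrow>
      (nat list \<Rightarrow> 'a list \<Rightarrow> real) \<Rightarrow> nat list \<Rightarrow> 'a list \<Rightarrow> real" where
  "coboundary E m B n k \<alpha> = (\<lambda>is.
    if is \<in> indices m (k + 1)
    then \<Sum>j = 1..k + 1. (-1) ^ (j + 1) *\<^sub>R
      restrict_zero (\<alpha> (omit j is)) (tests n (intersection E B is))
    else 0)"

text \<open>Exactness of \<open>U \<rightarrow> V \<rightarrow> W\<close> at \<open>V\<close>, for subspaces of ambient real vector spaces and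
  linear maps that are given on the ambient spaces.\<close>

definition exact_at ::
    "'u::real_vector set \<Rightarrow> ('u \<Rightarrow> 'v) \<Rightarrow> 'v::real_vector set \<Rightarrow> ('v \<Rightarrow> 'w) \<Rightarrow>
      'w::real_vector set \<Rightarrow> bool" where
  "exact_at U f V g W \<longleftrightarrow>
    subspace U \<and> subspace V \<and> subspace W \<and> linear f \<and> linear g \<and>
    f ` U \<subseteq> V \<and> g ` V \<subseteq> W \<and> f ` U = {v \<in> V. g v = 0}"

end

theory Submission
  imports Defs "HOL-Algebra.FiniteProduct"
begin

text \<open>The entries of a test generate a Boolean subalgebra, so every test of \<open>E\<close> lies in some block,
  and it lies in an intersection of blocks iff it lies in each of them. Evaluated at a test \<open>t\<close>, the
  sequence is therefore the augmented cochain complex of a nonempty full simplex, whose vertices are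
  the blocks containing \<open>t\<close>. Contracting each of these simplices to its first vertex gives a
  homotopy that preserves the cyclic condition, because that vertex depends only on the set of
  entries of \<open>t\<close>.\<close>

section \<open>Sums of tests\<close>

text \<open>Adjoining an absorbing element \<open>None\<close> for undefined sums turns an effect algebra into a
  commutative monoid, so that the library on finite products applies.\<close>

definition effect_monoid :: "'a effect_alg \<Rightarrow> 'a option monoid" where
  "effect_monoid E = \<lparr>carrier = insert None (Some ` carrier E),
     mult = (\<lambda>x y. Option.bind x (\<lambda>a. Option.bind y (osum E a))), one = Some (ezero E)\<rparr>"

lemma carrier_effect_monoid [simp]:
  "carrier (effect_monoid E) = insert None (Some ` carrier E)"
  and one_effect_monoid [simp]: "\<one>\<^bsub>effect_monoid E\<^esub> = Some (ezero E)"
  and mult_effect_monoid_Some [simp]: "Some a \<otimes>\<^bsub>effect_monoid E\<^esub> Some b = osum E a b"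
  and mult_effect_monoid_None [simp]:
    "None \<otimes>\<^bsub>effect_monoid E\<^esub> x = None" "x \<otimes>\<^bsub>effect_monoid E\<^esub> None = None"
  by (auto simp: effect_monoid_def bind_eq_None_conv)

context effect_algebra
begin

lemma osum_commute: "a \<in> carrier E \<Longrightarrow> b \<in> carrier E \<Longrightarrow> osum E a b = osum E b a"
  by (metis osum_comm option.exhaust)

lemma osum_zero_right: "a \<in> carrier E \<Longrightarrow> osum E a (ezero E) = Some a"
  using osum_commute[OF _ zero_closed] by (simp add: osum_zero)

lemma comm_monoid_effect_monoid: "comm_monoid (effect_monoid E)"
proof (rule comm_monoidI)
  show "x \<otimes>\<^bsub>effect_monoid E\<^esub> y \<in> carrier (effect_monoid E)"
    if "x \<in> carrier (effect_monoid E)" "y \<in> carrier (effect_monoid E)" for x y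
  proof (cases "x \<otimes>\<^bsub>effect_monoid E\<^esub> y")
    case (Some c)
    with that show ?thesis
      by (auto dest: osum_closed)
  qed auto
  show "x \<otimes>\<^bsub>effect_monoid E\<^esub> y = y \<otimes>\<^bsub>effect_monoid E\<^esub> x"
    if "x \<in> carrier (effect_monoid E)" "y \<in> carrier (effect_monoid E)" for x y
    using that by (auto simp: osum_commute)
  show "\<one>\<^bsub>effect_monoid E\<^esub> \<in> carrier (effect_monoid E)"
    by (simp add: zero_closed)
  show "\<one>\<^bsub>effect_monoid E\<^esub> \<otimes>\<^bsub>effect_monoid E\<^esub> x = x" if "x \<in> carrier (effect_monoid E)" for x
    using that by (auto simp: osum_zero)
  have right: "Some a \<otimes>\<^bsub>effect_monoid E\<^esub> (Some b \<otimes>\<^bsub>effect_monoid E\<^esub> Some c) = Some e"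
    if "a \<in> carrier E" "b \<in> carrier E" "c \<in> carrier E"
      and eq: "(Some a \<otimes>\<^bsub>effect_monoid E\<^esub> Some b) \<otimes>\<^bsub>effect_monoid E\<^esub> Some c = Some e" for a b c e
  proof -
    obtain d where "osum E a b = Some d" "osum E d c = Some e"
      using eq by (cases "osum E a b") auto
    then show ?thesis
      using osum_assoc[OF that(1-3)] by fastforce
  qed
  \<comment> \<open>The axiom gives only one direction of associativity. The other follows by
    applying it to \<open>c\<close>, \<open>b\<close>, \<open>a\<close> and commuting every
    sum.\<close>
  have left: "(Some a \<otimes>\<^bsub>effect_monoid E\<^esub> Some b) \<otimes>\<^bsub>effect_monoid E\<^esub> Some c = Some e"
    if mem: "a \<in> carrier E" "b \<in> carrier E" "c \<in> carrier E"
      and eq: "Some a \<otimes>\<^bsub>effect_monoid E\<^esub> (Some b \<otimes>\<^bsub>effect_monoid E\<^esub> Some c) = Some e" for a b c e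
  proof -
    obtain d where d: "osum E b c = Some d" "osum E a d = Some e"
      using eq by (cases "osum E b c") auto
    have dc: "d \<in> carrier E"
      using osum_closed d mem by blast
    have "osum E c b = Some d" "osum E d a = Some e"
      using d dc mem by (auto simp: osum_commute)
    then obtain f where f: "osum E b a = Some f" "osum E c f = Some e"
      using osum_assoc[of c b a] mem by blast
    have "f \<in> carrier E"
      using osum_closed f mem by blast
    with f mem show ?thesis
      by (simp add: osum_commute)
  qed
  show "(x \<otimes>\<^bsub>effect_monoid E\<^esub> y) \<otimes>\<^bsub>effect_monoid E\<^esub> z = x \<otimes>\<^bsub>effect_monoid E\<^esub> (y \<otimes>\<^bsub>effect_monoid E\<^esub> z)"
    if "x \<in> carrier (effect_monoid E)" "y \<in> carrier (effect_monoid E)"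
      "z \<in> carrier (effect_monoid E)" for x y z
  proof (cases "x = None \<or> y = None \<or> z = None")
    case False
    then obtain a b c where abc: "x = Some a" "y = Some b" "z = Some c"
      "a \<in> carrier E" "b \<in> carrier E" "c \<in> carrier E"
      using \<open>x \<in> _\<close> \<open>y \<in> _\<close> \<open>z \<in> _\<close> by auto
    show ?thesis
      unfolding abc(1-3) using left[OF abc(4-6)] right[OF abc(4-6)]
      by (metis option.exhaust)
  qed auto
qed

sublocale EM: comm_monoid "effect_monoid E"
  by (rule comm_monoid_effect_monoid)

lemma osum_list_closed: "set as \<subseteq> carrier E \<Longrightarrow> osum_list E as \<in> carrier (effect_monoid E)"
\<comment> \<open>Structural induction does not fit, because the recursion replaces the first two
  entries by their sum, which is a shorter list but not a tail.\<close>
proof (induction "length as" arbitrary: as)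
  case 0
  then show ?case
    by (simp add: zero_closed)
next
  case (Suc k)
  show ?case
  \<comment> \<open>Borrowed only for its split into no entry, one entry, and at least two
    entries.\<close>
  proof (cases as rule: remdups_adj.cases)
    case (3 a b bs)
    then show ?thesis
      using Suc.prems Suc.hyps(1)[of "_ # bs"] Suc.hyps(2) osum_closed[of a b]
      by (auto split: option.split)
  qed (use Suc.prems zero_closed in auto)
qed

lemma osum_list_Cons:
  "a \<in> carrier E \<Longrightarrow> set as \<subseteq> carrier E \<Longrightarrow>
    osum_list E (a # as) = Some a \<otimes>\<^bsub>effect_monoid E\<^esub> osum_list E as"
proof (induction as arbitrary: a)
  case Nil
  then show ?case
    by (simp add: osum_zero_right)
next
  case (Cons b bs)
  have "osum_list E (a # b # bs) =
      (Some a \<otimes>\<^bsub>effect_monoid E\<^esub> Some b) \<otimes>\<^bsub>effect_monoid E\<^esub> osum_list E bs"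
    using Cons osum_closed[of a b] by (auto split: option.split)
  also have "\<dots> = Some a \<otimes>\<^bsub>effect_monoid E\<^esub> (Some b \<otimes>\<^bsub>effect_monoid E\<^esub> osum_list E bs)"
    using Cons.prems osum_list_closed[of bs] by (intro EM.m_assoc) auto
  also have "Some b \<otimes>\<^bsub>effect_monoid E\<^esub> osum_list E bs = osum_list E (b # bs)"
    using Cons by simp
  finally show ?case .
qed

lemma osum_list_append:
  assumes "set as \<subseteq> carrier E" "set bs \<subseteq> carrier E"
  shows "osum_list E (as @ bs) = osum_list E as \<otimes>\<^bsub>effect_monoid E\<^esub> osum_list E bs"
  using assms(1)
proof (induction as)
  case Nil
  then show ?case
    using EM.l_one[OF osum_list_closed[OF assms(2)]] by simp
next
  case (Cons a as)
  then show ?case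
    using assms(2) osum_list_closed[of as] osum_list_closed[of bs]
      EM.m_assoc[of "Some a" "osum_list E as" "osum_list E bs"]
    by (simp add: osum_list_Cons del: osum_list.simps)
qed

lemma osum_list_eq_finprod:
  "set as \<subseteq> carrier E \<Longrightarrow>
    osum_list E as = finprod (effect_monoid E) (\<lambda>i. Some (as ! i)) {..<length as}"
proof (induction as rule: rev_induct)
  case (snoc a as)
  have "finprod (effect_monoid E) (\<lambda>i. Some ((as @ [a]) ! i)) {..<length as} =
      finprod (effect_monoid E) (\<lambda>i. Some (as ! i)) {..<length as}"
    using snoc.prems by (intro EM.finprod_cong') (auto simp: nth_append subset_code(1))
  moreover have "(\<lambda>i. Some ((as @ [a]) ! i)) \<in> {..<length as} \<rightarrow> carrier (effect_monoid E)"
    using snoc.prems by (auto simp: nth_append subset_code(1))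
  ultimately show ?case
    using snoc osum_list_closed[of as]
    by (simp add: lessThan_Suc osum_list_append EM.m_comm)
qed simp

text \<open>Commutativity lets the last entry move to the front. Hence the rotated tuple in the
  cyclic condition is again a test.\<close>

lemma rotate_tests: "as \<in> tests n E \<Longrightarrow> last as # butlast as \<in> tests n E"
proof -
  assume as: "as \<in> tests n E"
  then have ne: "as \<noteq> []" and sub: "set as \<subseteq> carrier E"
    by (auto simp: tests_def)
  then have mem: "set (butlast as) \<subseteq> carrier E" "last as \<in> carrier E"
    by (auto dest: in_set_butlastD)
  have "osum_list E (last as # butlast as) = osum_list E ([last as] @ butlast as)"
    by simp
  also have "\<dots> = osum_list E (butlast as @ [last as])"
    using mem osum_list_closed[of "butlast as"] osum_list_closed[of "[last as]"]
    by (simp only: osum_list_append[of "[last as]"] osum_list_append[of _ "[last as]"]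
        EM.m_comm list.set set_simps insert_subset empty_subsetI simp_thms)
  finally show ?thesis
    using as ne mem by (auto simp: tests_def)
qed

text \<open>Adding \<open>eone E\<close> to the zero sum is possible, so by associativity
  \<open>eone E\<close> can be added to \<open>b\<close>, which forces \<open>b\<close> to
  vanish.\<close>

lemma osum_eq_zero:
  assumes "a \<in> carrier E" "b \<in> carrier E" "osum E a b = Some (ezero E)"
  shows "b = ezero E"
proof -
  obtain f where "osum E b (eone E) = Some f"
    using osum_assoc[OF assms(1,2) one_closed assms(3) osum_zero[OF one_closed]] by blast
  then show ?thesis
    using osum_one[OF assms(2)] by simp
qed

end

section \<open>Blocks\<close>

text \<open>Transport of structure along \<open>f\<close>. The complement is a parameter rather than
  transported, so that it can be instantiated with \<open>orth E\<close>.\<close>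

lemma boolean_algebra_on_Pow:
  assumes f: "bij_betw f (Pow K) S" and compl: "\<And>I. I \<subseteq> K \<Longrightarrow> compl (f I) = f (K - I)"
  defines "g \<equiv> inv_into (Pow K) f"
  shows "boolean_algebra_on S (\<lambda>x y. f (g x \<inter> g y)) (\<lambda>x y. f (g x \<union> g y)) compl (f {}) (f K)"
proof -
  have gf: "g (f I) = I" if "I \<subseteq> K" for I
    using f that by (simp add: g_def bij_betw_inv_into_left)
  have fS: "f I \<in> S" if "I \<subseteq> K" for I
    using f that by (auto simp: bij_betw_def)
  have ex: "\<exists>I. I \<subseteq> K \<and> x = f I" if "x \<in> S" for x
    using f that by (auto simp: bij_betw_def)
  show ?thesis
  proof
    fix x y z assume "x \<in> S" "y \<in> S" "z \<in> S"
    then obtain I J L where "I \<subseteq> K" "x = f I" "J \<subseteq> K" "y = f J" "L \<subseteq> K" "z = f L"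
      using ex by metis
    then have "g x = I" "g y = J" "g z = L"
      by (simp_all only: gf)
    moreover have "g (f (I \<inter> J)) = I \<inter> J" "g (f (J \<inter> L)) = J \<inter> L" "g (f (I \<inter> L)) = I \<inter> L"
      and "g (f (I \<union> J)) = I \<union> J" "g (f (J \<union> L)) = J \<union> L" "g (f (I \<union> L)) = I \<union> L"
      by (rule gf, use \<open>I \<subseteq> K\<close> \<open>J \<subseteq> K\<close> \<open>L \<subseteq> K\<close> in blast)+
    ultimately show
      "f (g (f (g x \<inter> g y)) \<inter> g z) = f (g x \<inter> g (f (g y \<inter> g z)))"
      "f (g (f (g x \<union> g y)) \<union> g z) = f (g x \<union> g (f (g y \<union> g z)))"
      "f (g x \<inter> g (f (g y \<union> g z))) = f (g (f (g x \<inter> g y)) \<union> g (f (g x \<inter> g z)))"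
      "f (g x \<union> g (f (g y \<inter> g z))) = f (g (f (g x \<union> g y)) \<inter> g (f (g x \<union> g z)))"
      by (simp_all add: Int_assoc Un_assoc flip: Int_Un_distrib Un_Int_distrib)
  next
    fix x assume "x \<in> S"
    then obtain I where I: "I \<subseteq> K" "x = f I"
      using ex by metis
    then have "g x = I" "compl x = f (K - I)" "K - I \<subseteq> K"
      and "g (f K) = K" "g (f {}) = {}" "g (f (K - I)) = K - I"
      by (auto simp: gf compl)
    then show "compl x \<in> S" "f (g x \<inter> g (f K)) = x" "f (g x \<union> g (f {})) = x"
      "f (g x \<inter> g (compl x)) = f {}" "f (g x \<union> g (compl x)) = f K"
      using I by (simp_all add: fS Int_absorb2 Un_absorb1)
  next
    fix x y assume "x \<in> S" "y \<in> S"
    then obtain I J where I: "I \<subseteq> K" "x = f I" "J \<subseteq> K" "y = f J"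
      using ex by metis
    then have "g x = I" "g y = J" "I \<inter> J \<subseteq> K" "I \<union> J \<subseteq> K"
      by (auto simp: gf)
    then show "f (g x \<inter> g y) \<in> S" "f (g x \<union> g y) \<in> S"
      by (simp_all add: fS)
  qed (auto simp: fS Int_commute Un_commute)
qed

section \<open>Boolean subalgebras generated by tests\<close>

context orthoalgebra
begin

text \<open>The sub-sums of a test form a Boolean algebra isomorphic to the power set of the index set:
  if the sums over \<open>I\<close> and \<open>J\<close> can be added, then so can two copies of the sum over \<open>I \<inter> J\<close>,
  which therefore vanishes.\<close>

lemma boolean_subalgebra_subsums:
  assumes fin: "finite K" and a: "\<And>i. i \<in> K \<Longrightarrow> a i \<in> carrier E - {ezero E}"
    and one: "finprod (effect_monoid E) (\<lambda>i. Some (a i)) K = Some (eone E)"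
  obtains S where "boolean_subalgebra S E" "a ` K \<subseteq> S"
proof -
  define P where "P I = finprod (effect_monoid E) (\<lambda>i. Some (a i)) I" for I
  define f where "f I = the (P I)" for I
  have Pun: "P (I \<union> J) = P I \<otimes>\<^bsub>effect_monoid E\<^esub> P J"
    if "I \<subseteq> K" "J \<subseteq> K" "I \<inter> J = {}" for I J
    unfolding P_def using that a fin
    by (intro EM.finprod_Un_disjoint) (auto dest: finite_subset)
  have Pcl: "P I \<in> carrier (effect_monoid E)" if "I \<subseteq> K" for I
    unfolding P_def using that a by (intro EM.finprod_closed) auto
  have compl: "P I \<otimes>\<^bsub>effect_monoid E\<^esub> P (K - I) = Some (eone E)" if "I \<subseteq> K" for I
    using Pun[of I "K - I"] that one by (auto simp: P_def Un_absorb1)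
  \<comment> \<open>\<open>None\<close> is absorbing, so a sub-sum that its complement completes to
    \<open>eone E\<close> is defined; this justifies \<open>the\<close> in \<open>f\<close>.\<close>
  have Pf: "P I = Some (f I)" if "I \<subseteq> K" for I
    using compl[OF that] by (cases "P I") (auto simp: f_def)
  have fcl: "f I \<in> carrier E" if "I \<subseteq> K" for I
    using Pcl[OF that] by (auto simp: Pf[OF that])
  have Psing: "P {i} = Some (a i)" if "i \<in> K" for i
    unfolding P_def using a[OF that] by (simp add: osum_zero_right)
  have disj: "I \<inter> J = {}" if IJ: "I \<subseteq> K" "J \<subseteq> K" and d: "osum E (f I) (f J) \<noteq> None" for I J
  proof -
    define X where "X = I \<inter> J"
    have X: "X \<subseteq> K" "I - X \<subseteq> K" "J - X \<subseteq> K"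
      using IJ by (auto simp: X_def)
    have disjoint: "(I - X) \<inter> X = {}" "X \<inter> (J - X) = {}" and split: "I = (I - X) \<union> X" "J = X \<union> (J - X)"
      by (auto simp: X_def)
    have PI: "P I = P (I - X) \<otimes>\<^bsub>effect_monoid E\<^esub> P X"
      using Pun[OF X(2,1) disjoint(1)] split(1) by simp
    have PJ: "P J = P X \<otimes>\<^bsub>effect_monoid E\<^esub> P (J - X)"
      using Pun[OF X(1,3) disjoint(2)] split(2) by simp
    \<comment> \<open>Regrouping brings the two copies of the common part together; they can be
      added because the whole sum is defined.\<close>
    have "P I \<otimes>\<^bsub>effect_monoid E\<^esub> P J =
        P (I - X) \<otimes>\<^bsub>effect_monoid E\<^esub> (P X \<otimes>\<^bsub>effect_monoid E\<^esub> P X) \<otimes>\<^bsub>effect_monoid E\<^esub> P (J - X)"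
      unfolding PI PJ using Pcl X by (metis EM.m_assoc EM.m_closed)
    then have "osum E (f X) (f X) \<noteq> None"
      using d IJ X by (cases "osum E (f X) (f X)") (auto simp: Pf)
    then have fX: "f X = ezero E"
      using osum_self fcl X by blast
    show ?thesis
    proof (rule ccontr)
      assume "I \<inter> J \<noteq> {}"
      then obtain i where i: "i \<in> X"
        by (auto simp: X_def)
      with X have "i \<in> K" "X - {i} \<subseteq> K" by auto
      \<comment> \<open>Splitting off one index from the vanishing sum over \<open>X\<close> makes
        \<open>a i\<close> vanish, contrary to the choice of nonzero summands.\<close>
      then have "osum E (f (X - {i})) (a i) = Some (ezero E)"
        using Pun[of "X - {i}" "{i}"] X i fX Psing by (simp add: Pf insert_absorb)
      then have "a i = ezero E"
        using osum_eq_zero fcl \<open>X - {i} \<subseteq> K\<close> a \<open>i \<in> K\<close> by blast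
      then show False
        using a \<open>i \<in> K\<close> by blast
    qed
  qed
  \<comment> \<open>As \<open>f J\<close> can be added to \<open>f (K - J)\<close>, so can
    \<open>f I\<close>; then \<open>disj\<close> makes \<open>I\<close> disjoint from
    \<open>K - J\<close>. Exchanging the roles of \<open>I\<close> and \<open>J\<close> gives
    injectivity.\<close>
  have inj: "I \<subseteq> J" if IJ: "I \<subseteq> K" "J \<subseteq> K" and eq: "f I = f J" for I J
  proof -
    have "osum E (f I) (f (K - J)) \<noteq> None"
      using compl[OF \<open>J \<subseteq> K\<close>] IJ eq by (simp add: Pf)
    then show ?thesis
      using disj[of I "K - J"] IJ by auto
  qed
  have bij: "bij_betw f (Pow K) (f ` Pow K)"
    using inj by (intro inj_on_imp_bij_betw inj_onI) (simp add: subset_antisym)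
  have orth: "orth E (f I) = f (K - I)" if "I \<subseteq> K" for I
    using orth_unique[of "f I" "f (K - I)"] compl[OF that] fcl that by (simp add: Pf)
  have f0: "f {} = ezero E" and f1: "f K = eone E"
    using one by (simp_all add: f_def P_def)
  have gf: "inv_into (Pow K) f (f I) = I" if "I \<subseteq> K" for I
    using bij that by (simp add: bij_betw_inv_into_left)
  have osum: "osum E (f I) (f J) = (if I \<inter> J = {} then Some (f (I \<union> J)) else None)"
    if "I \<subseteq> K" "J \<subseteq> K" for I J
    using that disj[of I J] Pun[of I J] by (auto simp: Pf)
  have "subalgebra (f ` Pow K) E"
    unfolding subalgebra_def
  proof (intro conjI ballI allI impI)
    show "ezero E \<in> f ` Pow K" "eone E \<in> f ` Pow K"
      using f0 f1 by (metis Pow_bottom image_eqI, metis Pow_top image_eqI)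
  qed (auto simp: fcl orth osum split: if_splits)
  moreover have "boolean_effect_algebra (subalg E (f ` Pow K))"
    unfolding boolean_effect_algebra_def
  proof (intro exI conjI)
    show "boolean_algebra_on (carrier (subalg E (f ` Pow K)))
      (\<lambda>x y. f (inv_into (Pow K) f x \<inter> inv_into (Pow K) f y))
      (\<lambda>x y. f (inv_into (Pow K) f x \<union> inv_into (Pow K) f y))
      (orth (subalg E (f ` Pow K))) (ezero (subalg E (f ` Pow K))) (eone (subalg E (f ` Pow K)))"
      using boolean_algebra_on_Pow[OF bij, of "orth E"] orth by (simp add: subalg_def f0 f1)
    have "f (I \<inter> J) = ezero E \<longleftrightarrow> I \<inter> J = {}" if "I \<subseteq> K" for I J
      using inj[of "I \<inter> J" "{}"] f0 that by auto
    then show "\<forall>x\<in>carrier (subalg E (f ` Pow K)). \<forall>y\<in>carrier (subalg E (f ` Pow K)).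
      osum (subalg E (f ` Pow K)) x y =
        (if f (inv_into (Pow K) f x \<inter> inv_into (Pow K) f y) = ezero (subalg E (f ` Pow K))
         then Some (f (inv_into (Pow K) f x \<union> inv_into (Pow K) f y)) else None)"
      by (auto simp: subalg_def gf osum)
  qed
  moreover have "a ` K \<subseteq> f ` Pow K"
  proof
    fix x assume "x \<in> a ` K"
    then obtain i where "i \<in> K" "x = a i" by auto
    then have "x = f {i}"
      using Psing by (simp add: f_def)
    with \<open>i \<in> K\<close> show "x \<in> f ` Pow K" by blast
  qed
  ultimately show ?thesis
    using that by (simp add: boolean_subalgebra_def)
qed

lemma test_subset_block:
  assumes "finite (carrier E)" and as: "as \<in> tests n E"
  obtains S where "block E S" "set as \<subseteq> S"
proof -
  have sub: "set as \<subseteq> carrier E"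
    using as by (simp add: tests_def)
  \<comment> \<open>Zero entries are left out to meet the hypothesis of
    \<open>boolean_subalgebra_subsums\<close>; they return in \<open>asS\<close>, since a subalgebra
    contains \<open>ezero E\<close>.\<close>
  define K where "K = {i. i < length as \<and> as ! i \<noteq> ezero E}"
  have "finprod (effect_monoid E) (\<lambda>i. Some (as ! i)) {..<length as} =
      finprod (effect_monoid E) (\<lambda>i. Some (as ! i)) K"
    using sub by (intro EM.finprod_mono_neutral_cong_right) (auto simp: K_def subset_code(1))
  then have one: "finprod (effect_monoid E) (\<lambda>i. Some (as ! i)) K = Some (eone E)"
    using osum_list_eq_finprod[OF sub] as by (simp add: tests_def)
  obtain S where S: "boolean_subalgebra S E" "(!) as ` K \<subseteq> S"
  proof (rule boolean_subalgebra_subsums[OF _ _ one])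
    show "finite K" by (simp add: K_def)
    show "as ! i \<in> carrier E - {ezero E}" if "i \<in> K" for i
      using that sub by (auto simp: K_def)
  qed
  have asS: "set as \<subseteq> S"
  proof
    fix x assume "x \<in> set as"
    then obtain i where "i < length as" "x = as ! i"
      by (auto simp: in_set_conv_nth)
    then show "x \<in> S"
      using S by (cases "x = ezero E") (auto simp: K_def boolean_subalgebra_def subalgebra_def)
  qed
  \<comment> \<open>With only finitely many Boolean subalgebras, \<open>S\<close> extends to a
    maximal one, which is a block.\<close>
  have "finite {T. boolean_subalgebra T E}"
    using assms(1) by (rule finite_subset[rotated, OF iffD2[OF finite_Pow_iff]])
      (auto simp: boolean_subalgebra_def subalgebra_def)
  then obtain T where "boolean_subalgebra T E" "S \<subseteq> T"
    and "\<And>T'. boolean_subalgebra T' E \<Longrightarrow> T \<subseteq> T' \<Longrightarrow> T = T'"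
    using finite_has_maximal2[of "{T. boolean_subalgebra T E}" S] S(1) by auto
  then show ?thesis
    using that[of T] asS by (auto simp: block_def)
qed

end

section \<open>Alternating sums over omissions\<close>

text \<open>The simplicial coboundary with real coefficients, as it appears once a test is fixed.
  The length of the list replaces the explicit degree.\<close>

definition altsum :: "('b list \<Rightarrow> real) \<Rightarrow> 'b list \<Rightarrow> real" where
  "altsum f xs = (\<Sum>j = 1..length xs. (-1) ^ (j + 1) * f (omit j xs))"

lemma altsum_Nil [simp]: "altsum f [] = 0"
  by (simp add: altsum_def)

text \<open>Omitting the head has sign plus; every later position is shifted by one, which flips its
  sign. This recursion replaces manipulations of double sums.\<close>

lemma altsum_Cons: "altsum f (x # xs) = f xs - altsum (\<lambda>ys. f (x # ys)) xs"
proof -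
  have "altsum f (x # xs) = f xs + (\<Sum>j = Suc 1..Suc (length xs). (-1) ^ (j + 1) * f (omit j (x # xs)))"
    unfolding altsum_def by (subst sum.atLeast_Suc_atMost) (simp_all add: omit_def)
  also have "(\<Sum>j = Suc 1..Suc (length xs). (-1) ^ (j + 1) * f (omit j (x # xs))) =
      (\<Sum>j = 1..length xs. - ((-1) ^ (j + 1) * f (x # omit j xs)))"
    unfolding sum.shift_bounds_cl_Suc_ivl
    by (intro sum.cong) (auto simp: omit_def take_Cons')
  finally show ?thesis
    by (simp add: altsum_def sum_negf)
qed

lemma altsum_cong:
  "(\<And>j. 1 \<le> j \<Longrightarrow> j \<le> length xs \<Longrightarrow> f (omit j xs) = g (omit j xs)) \<Longrightarrow> altsum f xs = altsum g xs"
  by (simp add: altsum_def)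

lemma altsum_zero [simp]: "altsum (\<lambda>_. 0) xs = 0"
  by (simp add: altsum_def)

lemma altsum_add: "altsum (\<lambda>ys. f ys + g ys) xs = altsum f xs + altsum g xs"
  by (simp add: altsum_def distrib_left sum.distrib del: power_Suc)

lemma altsum_diff: "altsum (\<lambda>ys. f ys - g ys) xs = altsum f xs - altsum g xs"
  by (simp add: altsum_def right_diff_distrib sum_subtractf del: power_Suc)

lemma altsum_scale: "altsum (\<lambda>ys. c * f ys) xs = c * altsum f xs"
  by (simp add: altsum_def sum_distrib_left mult.left_commute)

text \<open>Expanding both sums at the head yields \<open>altsum f xs\<close> twice with opposite
  signs and a double sum over the tail, which vanishes by induction for another
  \<open>f\<close>.\<close>

lemma altsum_altsum: "altsum (altsum f) xs = 0"
  by (induction xs arbitrary: f) (simp_all add: altsum_Cons altsum_diff)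

lemma set_omit_subset: "set (omit j xs) \<subseteq> set xs"
  by (auto simp: omit_def dest: in_set_takeD in_set_dropD)

lemma omit_indices:
  assumes "is \<in> indices m (Suc k)" "1 \<le> j" "j \<le> length is"
  shows "omit j is \<in> indices m k"
proof -
  have "sorted_wrt (<) (take (j - 1) is @ drop (j - 1) is)"
    using assms(1) by (simp add: indices_def)
  moreover have "set (drop j is) \<subseteq> set (drop (j - 1) is)"
    by (simp add: set_drop_subset_set_drop)
  ultimately have "sorted_wrt (<) (omit j is)"
    unfolding omit_def sorted_wrt_append using sorted_wrt_drop assms(1)
    by (auto simp: indices_def)
  then show ?thesis
    using assms set_omit_subset[of j "is"] by (auto simp: indices_def omit_def)
qed

section \<open>The complex of a cover\<close>

lemma osum_list_subalg: "osum_list (subalg E S) as = osum_list E as"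
  by (induction E as rule: osum_list.induct) (auto simp: subalg_def split: option.split)

lemma sum_fun_apply: "(\<Sum>j\<in>A. f j) x = (\<Sum>j\<in>A. f j x)"
  for f :: "'i \<Rightarrow> 'b \<Rightarrow> 'c::comm_monoid_add"
  by (induction A rule: infinite_finite_induct) auto

text \<open>All summands are restricted to the same set of tests, so the restriction acts once,
  outside the alternating sum.\<close>

lemma coboundary_apply:
  "coboundary E m B n k \<alpha> is as =
    (if is \<in> indices m (Suc k) \<and> as \<in> tests n (intersection E B is)
     then altsum (\<lambda>ys. \<alpha> ys as) is else 0)"
  by (auto simp: coboundary_def altsum_def sum_fun_apply scaleR_fun_def restrict_zero_def
      indices_def intro!: sum.cong)

text \<open>Stated for a set of tuples rather than an algebra, so that it also applies to the empty
  index tuple below.\<close>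

definition cyclic_on :: "nat \<Rightarrow> 'a list set \<Rightarrow> ('a list \<Rightarrow> real) set" where
  "cyclic_on n X = {\<alpha>. (\<forall>as\<in>X. \<alpha> as = (-1) ^ n * \<alpha> (last as # butlast as)) \<and>
    (\<forall>as. as \<notin> X \<longrightarrow> \<alpha> as = 0)}"

lemma cyclic_cochains_eq: "cyclic_cochains n A = cyclic_on n (tests n A)"
  by (simp add: cyclic_cochains_def cyclic_on_def)

lemma subspace_cyclic_on: "subspace (cyclic_on n X)"
  unfolding subspace_def cyclic_on_def
  by (auto simp: scaleR_fun_def distrib_left mult.left_commute)

lemma subspace_cochain_sum: "subspace (cochain_sum E m B n k)"
  using subspace_cyclic_on
  unfolding subspace_def cochain_sum_def cyclic_cochains_eq by (auto simp: scaleR_fun_def fun_eq_iff)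

lemma linear_coboundary: "linear (coboundary E m B n k)"
  by (intro linearI)
    (auto simp: fun_eq_iff coboundary_apply scaleR_fun_def altsum_add altsum_scale)

lemma linear_restriction_map: "linear (restriction_map E m B n)"
  by (intro linearI) (auto simp: fun_eq_iff restriction_map_def scaleR_fun_def restrict_zero_def)

text \<open>Isolates what exactness uses of the blocks: they lie in the carrier and together they
  catch every test.\<close>

locale test_cover = effect_algebra E for E :: "'a effect_alg" +
  fixes B :: "nat \<Rightarrow> 'a set" and m n :: nat
  assumes B_subset: "i \<in> {1..m} \<Longrightarrow> B i \<subseteq> carrier E"
    and cover: "as \<in> tests n E \<Longrightarrow> \<exists>i\<in>{1..m}. set as \<subseteq> B i"
begin

text \<open>For \<open>[]\<close> this gives all tests of \<open>E\<close>, whereas the empty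
  intersection in \<open>intersection\<close> is the whole type. Hence the two are compared only for
  nonempty index tuples.\<close>

definition tests_on :: "nat list \<Rightarrow> 'a list set" where
  "tests_on is = {as \<in> tests n E. \<forall>i\<in>set is. set as \<subseteq> B i}"

lemma tests_intersection:
  assumes "is \<in> indices m (Suc k)"
  shows "tests n (intersection E B is) = tests_on is"
proof -
  have "is \<noteq> []" "set is \<subseteq> {1..m}"
    using assms by (auto simp: indices_def)
  then have "(\<Inter>i\<in>set is. B i) \<subseteq> carrier E"
    using B_subset by (cases "is") auto
  then have "tests n (intersection E B is) = {as \<in> tests n E. set as \<subseteq> (\<Inter>i\<in>set is. B i)}"
    by (auto simp: tests_def intersection_def osum_list_subalg) (auto simp: subalg_def)
  then show ?thesis
    unfolding tests_on_def by auto
qed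

lemma set_rotate_test: "as \<in> tests n E \<Longrightarrow> set (last as # butlast as) = set as"
proof -
  assume "as \<in> tests n E"
  then have "set (butlast as @ [last as]) = set as"
    by (subst append_butlast_last_id) (auto simp: tests_def)
  then show ?thesis by simp
qed

lemma rotate_tests_on: "as \<in> tests_on is \<Longrightarrow> last as # butlast as \<in> tests_on is"
  unfolding tests_on_def using rotate_tests set_rotate_test
  by (auto simp del: set_simps list.set)

text \<open>In contrast to \<^const>\<open>cochain_sum\<close>, the case \<open>k = 0\<close> is the term \<open>C\<^sub>\<lambda>\<^sup>n(E)\<close>, so that the
  restriction map becomes the coboundary in degree \<open>0\<close>.\<close>

definition cochains :: "nat \<Rightarrow> (nat list \<Rightarrow> 'a list \<Rightarrow> real) set" where
  "cochains k = {\<alpha>. (\<forall>is\<in>indices m k. \<alpha> is \<in> cyclic_on n (tests_on is)) \<and>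
    (\<forall>is. is \<notin> indices m k \<longrightarrow> \<alpha> is = 0)}"

lemma cochain_sum_eq: "cochain_sum E m B n (Suc k) = cochains (Suc k)"
  unfolding cochain_sum_def cochains_def cyclic_cochains_eq
  by (intro Collect_cong conj_cong ball_cong refl) (simp add: tests_intersection)

lemma coboundary_eq:
  "coboundary E m B n k \<alpha> is as =
    (if is \<in> indices m (Suc k) \<and> as \<in> tests_on is then altsum (\<lambda>ys. \<alpha> ys as) is else 0)"
  by (simp add: coboundary_apply tests_intersection cong: conj_cong)

lemma tests_on_omit: "as \<in> tests_on is \<Longrightarrow> as \<in> tests_on (omit j is)"
  using set_omit_subset[of j "is"] by (auto simp: tests_on_def)

lemma coboundary_in_cochains:
  assumes "\<alpha> \<in> cochains k"
  shows "coboundary E m B n k \<alpha> \<in> cochains (Suc k)"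
  unfolding cochains_def mem_Collect_eq
proof (intro conjI allI impI ballI)
  fix "is" assume is_in: "is \<in> indices m (Suc k)"
  show "coboundary E m B n k \<alpha> is \<in> cyclic_on n (tests_on is)"
    unfolding cyclic_on_def mem_Collect_eq
  proof (intro conjI allI impI ballI)
    fix as assume as: "as \<in> tests_on is"
    have "altsum (\<lambda>ys. \<alpha> ys as) is = altsum (\<lambda>ys. (-1) ^ n * \<alpha> ys (last as # butlast as)) is"
    proof (rule altsum_cong)
      fix j assume "1 \<le> j" "j \<le> length is"
      then have "\<alpha> (omit j is) \<in> cyclic_on n (tests_on (omit j is))"
        using assms omit_indices[OF is_in] by (simp add: cochains_def)
      then show "\<alpha> (omit j is) as = (-1) ^ n * \<alpha> (omit j is) (last as # butlast as)"
        using tests_on_omit[OF as] by (simp add: cyclic_on_def)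
    qed
    then show "coboundary E m B n k \<alpha> is as =
        (-1) ^ n * coboundary E m B n k \<alpha> is (last as # butlast as)"
      using as is_in rotate_tests_on by (simp add: coboundary_eq altsum_scale)
  qed (simp add: coboundary_eq)
qed (simp add: coboundary_eq fun_eq_iff)

lemma coboundary_coboundary: "coboundary E m B n (Suc k) (coboundary E m B n k \<alpha>) = 0"
proof (intro ext)
  fix "is" as
  show "coboundary E m B n (Suc k) (coboundary E m B n k \<alpha>) is as = 0 is as"
  proof (cases "is \<in> indices m (Suc (Suc k)) \<and> as \<in> tests_on is")
    case True
    \<comment> \<open>Omitting an index keeps the tuple admissible and the test in the larger
      intersection, so the inner coboundary is never cut off to zero here.\<close>
    then have "altsum (\<lambda>ys. coboundary E m B n k \<alpha> ys as) is = altsum (altsum (\<lambda>ys. \<alpha> ys as)) is"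
      by (intro altsum_cong) (simp add: coboundary_eq omit_indices tests_on_omit)
    with True show ?thesis
      by (simp add: coboundary_eq[of "Suc k"] altsum_altsum)
  qed (auto simp: coboundary_eq[of "Suc k"])
qed

section \<open>The contracting homotopy\<close>

definition first :: "'a list \<Rightarrow> nat" where
  "first as = (LEAST i. i \<in> {1..m} \<and> set as \<subseteq> B i)"

lemma first:
  assumes "as \<in> tests n E"
  shows "first as \<in> {1..m}" "set as \<subseteq> B (first as)"
proof -
  have "first as \<in> {1..m} \<and> set as \<subseteq> B (first as)"
    unfolding first_def by (rule LeastI_ex) (use cover[OF assms] in \<open>simp add: Bex_def\<close>)
  then show "first as \<in> {1..m}" "set as \<subseteq> B (first as)"
    by simp_all
qed

lemma first_le: "i \<in> {1..m} \<Longrightarrow> set as \<subseteq> B i \<Longrightarrow> first as \<le> i"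
  unfolding first_def by (rule Least_le) simp

lemma first_rotate: "as \<in> tests n E \<Longrightarrow> first (last as # butlast as) = first as"
  by (simp only: first_def set_rotate_test)

text \<open>The contracted vertex is the least one, hence the first entry of every index tuple that
  contains it, so no signs occur.\<close>

definition homotopy :: "nat \<Rightarrow> (nat list \<Rightarrow> 'a list \<Rightarrow> real) \<Rightarrow> nat list \<Rightarrow> 'a list \<Rightarrow> real" where
  "homotopy k \<beta> = (\<lambda>is as.
    if is \<in> indices m k \<and> as \<in> tests_on is \<and> first as \<notin> set is then \<beta> (first as # is) as else 0)"

text \<open>Every entry of \<open>is\<close> competes in the minimum defining
  \<open>first as\<close>, so \<open>first as\<close> lies strictly below all entries once it is not
  among them.\<close>

lemma first_Cons_indices:
  assumes "is \<in> indices m k" "as \<in> tests_on is" "first as \<notin> set is"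
  shows "first as # is \<in> indices m (Suc k)" "as \<in> tests_on (first as # is)"
proof -
  have as: "as \<in> tests n E" "\<And>i. i \<in> set is \<Longrightarrow> set as \<subseteq> B i"
    using assms(2) by (auto simp: tests_on_def)
  have "first as < i" if "i \<in> set is" for i
    using first_le[of i as] as(2)[OF that] assms(1,3) that
    by (metis (mono_tags, lifting) indices_def mem_Collect_eq order_le_imp_less_or_eq subsetD)
  then show "first as # is \<in> indices m (Suc k)"
    using assms(1) first(1)[OF as(1)] by (auto simp: indices_def)
  show "as \<in> tests_on (first as # is)"
    using assms(2) first(2)[OF as(1)] by (simp add: tests_on_def)
qed

lemma homotopy_in_cochains:
  assumes "\<beta> \<in> cochains (Suc k)"
  shows "homotopy k \<beta> \<in> cochains k"
  unfolding cochains_def mem_Collect_eq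
proof (intro conjI allI impI ballI)
  fix "is" assume is_in: "is \<in> indices m k"
  show "homotopy k \<beta> is \<in> cyclic_on n (tests_on is)"
    unfolding cyclic_on_def mem_Collect_eq
  proof (intro conjI allI impI ballI)
    fix as assume as: "as \<in> tests_on is"
    then have "first (last as # butlast as) = first as"
      by (intro first_rotate) (simp add: tests_on_def)
    moreover have "\<beta> (first as # is) as = (-1) ^ n * \<beta> (first as # is) (last as # butlast as)"
      if "first as \<notin> set is"
      using first_Cons_indices[OF is_in as that] assms by (auto simp: cochains_def cyclic_on_def)
    ultimately show "homotopy k \<beta> is as = (-1) ^ n * homotopy k \<beta> is (last as # butlast as)"
      using is_in as rotate_tests_on[OF as] by (simp add: homotopy_def)
  qed (simp add: homotopy_def)
qed (simp add: homotopy_def fun_eq_iff)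

text \<open>This is the homotopy identity dh + hd = id evaluated on a cocycle, where the term hd
  drops out.\<close>

lemma coboundary_homotopy:
  assumes \<beta>: "\<beta> \<in> cochains (Suc k)" and cocycle: "coboundary E m B n (Suc k) \<beta> = 0"
  shows "coboundary E m B n k (homotopy k \<beta>) = \<beta>"
proof (intro ext)
  fix "is" as
  show "coboundary E m B n k (homotopy k \<beta>) is as = \<beta> is as"
  proof (cases "is \<in> indices m (Suc k) \<and> as \<in> tests_on is")
    case False
    then have "\<beta> is as = 0"
      using \<beta> by (cases "is \<in> indices m (Suc k)") (auto simp: cochains_def cyclic_on_def)
    with False show ?thesis
      by (auto simp: coboundary_eq)
  next
    case True
    then have is_in: "is \<in> indices m (Suc k)" and as: "as \<in> tests_on is" by auto
    have "altsum (\<lambda>ys. homotopy k \<beta> ys as) is = \<beta> is as"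
    proof (cases "first as \<in> set is")
      \<comment> \<open>The cocycle condition at \<open>first as # is\<close>, expanded at its head,
        equates \<open>\<beta> is as\<close> with the alternating sum of the homotopy.\<close>
      case False
      note Cons = first_Cons_indices[OF is_in as False]
      have "altsum (\<lambda>ys. homotopy k \<beta> ys as) is = altsum (\<lambda>ys. \<beta> (first as # ys) as) is"
        using False set_omit_subset[of _ "is"] omit_indices[OF is_in] tests_on_omit[OF as]
        by (intro altsum_cong) (auto simp: homotopy_def)
      moreover have "altsum (\<lambda>ys. \<beta> ys as) (first as # is) = 0"
        using coboundary_eq[of "Suc k" \<beta> "first as # is" as] Cons cocycle by simp
      ultimately show ?thesis
        by (simp add: altsum_Cons)
    next
      \<comment> \<open>Now \<open>first as\<close> is the head of \<open>is\<close>. Omitting any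
        other entry keeps it, and there the homotopy vanishes; only the omission of the head
        contributes.\<close>
      case first_in: True
      obtain i js where eq: "is = i # js"
        using is_in by (cases "is") (auto simp: indices_def)
      have "first as \<le> i"
        using is_in as by (intro first_le) (auto simp: eq indices_def tests_on_def)
      then have i: "i = first as"
        using is_in first_in by (auto simp: eq indices_def)
      have "homotopy k \<beta> js as = \<beta> is as"
        using is_in as by (auto simp: homotopy_def eq i indices_def tests_on_def)
      moreover have "homotopy k \<beta> (i # ys) as = 0" for ys
        by (simp add: homotopy_def i)
      ultimately show ?thesis
        by (simp add: eq altsum_Cons)
    qed
    with True show ?thesis
      by (simp add: coboundary_eq)
  qed
qed

section \<open>Exactness at each term\<close>

lemma coboundary_exact:
  "coboundary E m B n k ` cochains k = {\<beta> \<in> cochains (Suc k). coboundary E m B n (Suc k) \<beta> = 0}"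
proof (intro equalityI subsetI)
  fix \<beta> assume "\<beta> \<in> {\<beta> \<in> cochains (Suc k). coboundary E m B n (Suc k) \<beta> = 0}"
  then show "\<beta> \<in> coboundary E m B n k ` cochains k"
    using coboundary_homotopy[of \<beta> k] homotopy_in_cochains[of \<beta> k]
    by (metis (mono_tags, lifting) image_eqI mem_Collect_eq)
qed (auto simp: coboundary_in_cochains coboundary_coboundary)

text \<open>Omitting the only entry of \<open>[i]\<close> leaves \<open>[]\<close>, with sign plus,
  so exactness at the first direct sum becomes the case \<open>k = 0\<close> of
  \<open>coboundary_exact\<close>.\<close>

lemma restriction_map_eq:
  "restriction_map E m B n \<alpha> = coboundary E m B n 0 (\<lambda>is. if is = [] then \<alpha> else 0)"
  by (auto simp: restriction_map_def coboundary_def fun_eq_iff omit_def indices_def)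

lemma cochains_0: "cochains 0 = (\<lambda>\<alpha> is. if is = [] then \<alpha> else 0) ` cyclic_cochains n E"
proof -
  have idx: "indices m 0 = {[]}"
    by (auto simp: indices_def)
  show ?thesis
  proof (intro equalityI subsetI)
    fix \<alpha> assume "\<alpha> \<in> cochains 0"
    then have "\<alpha> = (\<lambda>is. if is = [] then \<alpha> [] else 0)" "\<alpha> [] \<in> cyclic_cochains n E"
      by (auto simp: cochains_def idx tests_on_def cyclic_cochains_eq)
    then show "\<alpha> \<in> (\<lambda>\<alpha> is. if is = [] then \<alpha> else 0) ` cyclic_cochains n E"
      by (rule image_eqI)
  qed (auto simp: cochains_def idx tests_on_def cyclic_cochains_eq)
qed

lemma restriction_map_image:
  "restriction_map E m B n ` cyclic_cochains n E = coboundary E m B n 0 ` cochains 0"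
  by (simp add: restriction_map_eq cochains_0 image_image)

text \<open>A test lies in some \<open>B i\<close>, so the component at \<open>[i]\<close> already
  determines the value of the cochain there. This is exactness at the leftmost term, where no
  homotopy is required.\<close>

lemma restriction_map_eq_0_iff:
  assumes "\<alpha> \<in> cyclic_cochains n E"
  shows "restriction_map E m B n \<alpha> = 0 \<longleftrightarrow> \<alpha> = 0"
proof
  assume zero: "restriction_map E m B n \<alpha> = 0"
  have "\<alpha> as = 0" for as
  proof (cases "as \<in> tests n E")
    case True
    then obtain i where i: "i \<in> {1..m}" "set as \<subseteq> B i"
      using cover by blast
    then have "[i] \<in> indices m (Suc 0)" "as \<in> tests_on [i]"
      using True by (auto simp: indices_def tests_on_def)
    then show ?thesis
      using fun_cong[OF fun_cong[OF zero], of "[i]" as]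
      by (simp add: restriction_map_eq coboundary_eq altsum_Cons)
  next
    case False
    with assms show ?thesis
      by (simp add: cyclic_cochains_def)
  qed
  then show "\<alpha> = 0" by (simp add: fun_eq_iff)
qed (auto simp: restriction_map_def restrict_zero_def fun_eq_iff)

lemma exact_at_cyclic_cochains:
  "exact_at {0 :: real} (\<lambda>_. 0) (cyclic_cochains n E) (restriction_map E m B n)
    (cochain_sum E m B n 1)"
  unfolding exact_at_def
proof (intro conjI)
  show "linear (\<lambda>_ :: real. 0 :: 'a list \<Rightarrow> real)"
    by (intro linearI) auto
  have zero: "0 \<in> cyclic_cochains n E"
    by (simp add: cyclic_cochains_def)
  then show "(\<lambda>_. 0) ` {0 :: real} \<subseteq> cyclic_cochains n E"
    by simp
  show "restriction_map E m B n ` cyclic_cochains n E \<subseteq> cochain_sum E m B n 1"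
    unfolding restriction_map_image using coboundary_in_cochains[of _ 0] cochain_sum_eq[of 0] by auto
  show "(\<lambda>_. 0) ` {0 :: real} = {v \<in> cyclic_cochains n E. restriction_map E m B n v = 0}"
    using zero by (auto simp: restriction_map_eq_0_iff)
qed (auto simp: subspace_cyclic_on cyclic_cochains_eq subspace_cochain_sum linear_restriction_map)

lemma exact_at_cochain_sum_1:
  "exact_at (cyclic_cochains n E) (restriction_map E m B n)
    (cochain_sum E m B n 1) (coboundary E m B n 1) (cochain_sum E m B n 2)"
  unfolding exact_at_def restriction_map_image
  using coboundary_exact[of 0] cochain_sum_eq[of 0] cochain_sum_eq[of 1]
    coboundary_in_cochains[of _ 0] coboundary_in_cochains[of _ 1]
    subspace_cochain_sum[of E m B n 1] subspace_cochain_sum[of E m B n 2]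
  by (auto simp: subspace_cyclic_on cyclic_cochains_eq linear_restriction_map
      linear_coboundary numeral_2_eq_2)

lemma exact_at_cochain_sum:
  assumes "k \<ge> 1"
  shows "exact_at (cochain_sum E m B n k) (coboundary E m B n k)
    (cochain_sum E m B n (k + 1)) (coboundary E m B n (k + 1)) (cochain_sum E m B n (k + 2))"
proof -
  have "cochain_sum E m B n k = cochains k" "cochain_sum E m B n (k + 1) = cochains (Suc k)"
    "cochain_sum E m B n (k + 2) = cochains (Suc (Suc k))"
    \<comment> \<open>\<open>cochain_sum_eq\<close> speaks of successors only, so \<open>k\<close>
      is written as the successor of \<open>k - 1\<close>.\<close>
    using assms cochain_sum_eq[of "k - 1"] cochain_sum_eq[of k] cochain_sum_eq[of "Suc k"] by simp_all
  then show ?thesis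
    unfolding exact_at_def using coboundary_exact[of k] coboundary_in_cochains
      subspace_cochain_sum[of E m B n k] subspace_cochain_sum[of E m B n "k + 1"]
      subspace_cochain_sum[of E m B n "k + 2"]
    by (auto simp: linear_coboundary)
qed

end

theorem proposition8p1:
  fixes E :: "'a effect_alg" and B :: "nat \<Rightarrow> 'a set" and m n :: nat
  assumes "orthoalgebra E"
    and "finite (carrier E)"
    and "bij_betw B {1..m} {S. block E S}"
  shows "exact_at {0 :: real} (\<lambda>_. 0)
           (cyclic_cochains n E) (restriction_map E m B n)
           (cochain_sum E m B n 1)
       \<and> exact_at (cyclic_cochains n E) (restriction_map E m B n)
           (cochain_sum E m B n 1) (coboundary E m B n 1)
           (cochain_sum E m B n 2)
       \<and> (\<forall>k\<ge>1. exact_at (cochain_sum E m B n k) (coboundary E m B n k)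
           (cochain_sum E m B n (k + 1)) (coboundary E m B n (k + 1))
           (cochain_sum E m B n (k + 2)))"
proof -
  interpret orthoalgebra E
    by fact
  have blocks: "B ` {1..m} = {S. block E S}"
    using assms(3) by (simp add: bij_betw_def)
  \<comment> \<open>Each \<open>B i\<close> is a block, hence a subset of the carrier, and every
    block is some \<open>B i\<close>, so the block containing a given test is in the family.\<close>
  interpret test_cover E B m n
  proof
    show "B i \<subseteq> carrier E" if "i \<in> {1..m}" for i
    proof -
      have "block E (B i)"
        using blocks that by blast
      then show ?thesis
        by (simp add: block_def boolean_subalgebra_def subalgebra_def)
    qed
    show "\<exists>i\<in>{1..m}. set as \<subseteq> B i" if as: "as \<in> tests n E" for as
    proof -
      obtain S where "block E S" "set as \<subseteq> S"
        using test_subset_block[OF assms(2) as] .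
      moreover from this obtain i where "i \<in> {1..m}" "S = B i"
        using blocks by (metis imageE mem_Collect_eq)
      ultimately show ?thesis
        by metis
    qed
  qed
  show ?thesis
    by (intro conjI allI impI exact_at_cyclic_cochains exact_at_cochain_sum_1 exact_at_cochain_sum)
qed

end
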